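(* Let $\mathbf{b}=(b_i)_{i\ge0}$ be a sequence of nonzero elements of a field and $\mathbf{a}=(a_i)_{i\ge1}$ a sequence in that field. Define $\mathbf{b}'=(b_i^{-1})_{i\ge0}$ and $\mathbf{a}'=(a_ib_{i-1}^{-1}b_i^{-1})_{i\ge1}$. Then for all positive integers $n$ and $k$, \[ \sigma^{\le k}_{-n}(\mathbf{b},\mathbf{a})=b_0^{-1}\sum_{\pi\in\mathrm{Sch}^{\le k}_{2n-2}}\mathrm{wt}(\pi;\mathbf{b}',\mathbf{a}')=b_0^{-1}\sigma^{\le k}_{n-1}(\mathbf{b}',\mathbf{a}'). \]
   Context: A Schröder path is a finite sequence of points of $\mathbb{Z}\times\mathbb{Z}_{\ge0}$ whose steps are each $(1,1)$ (up), $(2,0)$ (double-horizontal) or $(1,-1)$ (down). For sequences $\mathbf{b}=(b_i)_{i\ge0}$, $\mathbf{a}=(a_i)_{i\ge1}$, the weight $\mathrm{wt}(\pi;\mathbf{b},\mathbf{a})$ is the product of $b_i$ over double-horizontal steps starting at height $i$ and of $a_i$ over down steps starting at height $i$. $\mathrm{Sch}^{\le k}_{N}$ is the set of Schröder paths from $(0,0)$ to $(N,0)$ staying weakly below $y=k$, and $\sigma^{\le k}_n(\mathbf{b},\mathbf{a})=\sum_{\pi\in\mathrm{Sch}^{\le k}_{2n}}\mathrm{wt}(\pi;\mathbf{b},\mathbf{a})$ for $n\ge0$. If $(f_n)_{n\ge0}$ satisfies $f_n=c_1f_{n-1}+\cdots+c_df_{n-d}$ for all $n\ge d$ with $c_d\ne0$,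 it is extended uniquely to all $n\in\mathbb{Z}$ so that the recurrence holds for all $n$; $\sigma^{\le k}_{-n}(\mathbf{b},\mathbf{a})$ ($n\ge1$) denotes this extension (it exists when all $b_i\ne0$). *)

theory Defs
  imports Complex_Main
begin

text \<open>A point is a pair of type \<^typ>\<open>int \<times> nat\<close>; a path is the list of the points it visits.\<close>

type_synonym point = "int \<times> nat"

definition up_step :: "point \<Rightarrow> point \<Rightarrow> bool" where
  "up_step p q \<longleftrightarrow> fst q = fst p + 1 \<and> snd q = snd p + 1"

definition horiz_step :: "point \<Rightarrow> point \<Rightarrow> bool" where
  "horiz_step p q \<longleftrightarrow> fst q = fst p + 2 \<and> snd q = snd p"

definition down_step :: "point \<Rightarrow> point \<Rightarrow> bool" where
  "down_step p q \<longleftrightarrow> fst q = fst p + 1 \<and> snd p = snd q + 1"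

definition schroeder_path :: "point list \<Rightarrow> bool" where
  "schroeder_path \<pi> \<longleftrightarrow> \<pi> \<noteq> [] \<and>
     successively (\<lambda>p q. up_step p q \<or> horiz_step p q \<or> down_step p q) \<pi>"

definition Sch :: "nat \<Rightarrow> nat \<Rightarrow> point list set" where
  "Sch k N = {\<pi>. schroeder_path \<pi> \<and> hd \<pi> = (0, 0) \<and> last \<pi> = (int N, 0) \<and>
                 (\<forall>p\<in>set \<pi>. snd p \<le> k)}"

lemma schroeder_path_bounds:
  assumes "schroeder_path \<pi>"
  shows "fst (hd \<pi>) + int (length \<pi>) \<le> fst (last \<pi>) + 1 \<and>
         (\<forall>p\<in>set \<pi>. fst (hd \<pi>) \<le> fst p \<and> fst p \<le> fst (last \<pi>))"
  using assms
proof (induction \<pi>)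
  case Nil
  then show ?case by (simp add: schroeder_path_def)
next
  case (Cons p \<pi>)
  show ?case
  proof (cases \<pi>)
    case Nil
    then show ?thesis by simp
  next
    case (Cons q \<rho>)
    have path: "schroeder_path \<pi>" and "fst p < fst (hd \<pi>)"
      using Cons.prems Cons
      by (auto simp: schroeder_path_def up_step_def horiz_step_def down_step_def)
    moreover have "hd \<pi> \<in> set \<pi>" using Cons by simp
    ultimately show ?thesis
      using Cons.IH[OF path] Cons by fastforce
  qed
qed

text \<open>Finiteness makes the sums over \<open>Sch k N\<close> meaningful.\<close>

lemma finite_Sch: "finite (Sch k N)"
proof (rule finite_subset)
  show "Sch k N \<subseteq> {\<pi>. set \<pi> \<subseteq> {0..int N} \<times> {..k} \<and> length \<pi> \<le> N + 1}"
    unfolding Sch_def using schroeder_path_bounds by fastforce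
  show "finite {\<pi>. set \<pi> \<subseteq> {0..int N} \<times> {..k} \<and> length \<pi> \<le> N + 1}"
    by (rule finite_lists_length_le) simp
qed

text \<open>The sequence \<open>a\<close> is indexed from 1: down steps start at positive height, so \<open>a 0\<close> is never used.\<close>

definition wt :: "point list \<Rightarrow> (nat \<Rightarrow> 'a::field) \<Rightarrow> (nat \<Rightarrow> 'a) \<Rightarrow> 'a" where
  "wt \<pi> b a =
     (\<Prod>j | Suc j < length \<pi> \<and> horiz_step (\<pi> ! j) (\<pi> ! Suc j). b (snd (\<pi> ! j))) *
     (\<Prod>j | Suc j < length \<pi> \<and> down_step (\<pi> ! j) (\<pi> ! Suc j). a (snd (\<pi> ! j)))"

definition sigma :: "nat \<Rightarrow> (nat \<Rightarrow> 'a::field) \<Rightarrow> (nat \<Rightarrow> 'a) \<Rightarrow> nat \<Rightarrow> 'a" where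
  "sigma k b a n = (\<Sum>\<pi>\<in>Sch k (2 * n). wt \<pi> b a)"

definition satisfies_recurrence :: "nat \<Rightarrow> (nat \<Rightarrow> 'a::field) \<Rightarrow> (nat \<Rightarrow> 'a) \<Rightarrow> bool" where
  "satisfies_recurrence d c f \<longleftrightarrow>
     d \<ge> 1 \<and> c d \<noteq> 0 \<and> (\<forall>n\<ge>d. f n = (\<Sum>i=1..d. c i * f (n - i)))"

definition is_extension :: "(nat \<Rightarrow> 'a::field) \<Rightarrow> (int \<Rightarrow> 'a) \<Rightarrow> bool" where
  "is_extension f g \<longleftrightarrow> (\<exists>d c. satisfies_recurrence d c f \<and>
     (\<forall>n. g n = (\<Sum>i=1..d. c i * g (n - int i))) \<and>
     (\<forall>n. g (int n) = f n))"

text \<open>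
  The extension does not depend on the recurrence used to construct it (see
  \<open>is_extension_unique\<close> below), so the description is proper whenever \<open>f\<close>
  satisfies some recurrence; otherwise the value is unspecified.
\<close>

definition extension :: "(nat \<Rightarrow> 'a::field) \<Rightarrow> int \<Rightarrow> 'a" where
  "extension f = (THE g. is_extension f g)"

definition sigma_ext :: "nat \<Rightarrow> (nat \<Rightarrow> 'a::field) \<Rightarrow> (nat \<Rightarrow> 'a) \<Rightarrow> int \<Rightarrow> 'a" where
  "sigma_ext k b a = extension (sigma k b a)"

lemma recurrence_zero:
  fixes u :: "int \<Rightarrow> 'a::field"
  assumes d: "d \<ge> 1" "c d \<noteq> 0"
    and rec: "\<And>n. u n = (\<Sum>i=1..d. c i * u (n - int i))"
    and zero: "\<And>n. n \<ge> N \<Longrightarrow> u n = 0"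
  shows "u n = 0"
proof -
  have "\<forall>n\<ge>N - int m. u n = 0" for m
  proof (induction m)
    case 0
    then show ?case using zero by simp
  next
    case (Suc m)
    let ?n = "N - int (Suc m)"
    have "u ?n = 0"
    proof -
      have "0 = u (?n + int d)" using Suc d(1) by simp
      also have "\<dots> = (\<Sum>i=1..d. c i * u (?n + int d - int i))" by (rule rec)
      also have "\<dots> = (\<Sum>i\<in>{d}. c i * u (?n + int d - int i))"
        by (rule sum.mono_neutral_right) (use d Suc in auto)
      finally show ?thesis using d by simp
    qed
    show ?case
    proof (intro allI impI)
      fix n assume "n \<ge> ?n"
      then have "n = ?n \<or> n \<ge> N - int m" by simp linarith
      then show "u n = 0" using Suc \<open>u ?n = 0\<close> by blast
    qed
  qed
  from this[of "nat (N - n)"] show ?thesis by simp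
qed

lemma is_extension_unique:
  fixes f :: "nat \<Rightarrow> 'a::field"
  assumes "is_extension f g" "is_extension f h"
  shows "g = h"
proof
  fix m
  obtain d c where d: "d \<ge> 1" "c d \<noteq> 0"
    and g: "\<And>n. g n = (\<Sum>i=1..d. c i * g (n - int i))" "\<And>n. g (int n) = f n"
    using assms(1) unfolding is_extension_def satisfies_recurrence_def by metis
  obtain e c' where e: "e \<ge> 1" "c' e \<noteq> 0"
    and h: "\<And>n. h n = (\<Sum>i=1..e. c' i * h (n - int i))" "\<And>n. h (int n) = f n"
    using assms(2) unfolding is_extension_def satisfies_recurrence_def by metis
  define w where "w n = g n - h n" for n
  define u where "u n = w n - (\<Sum>j=1..e. c' j * w (n - int j))" for n
  have w0: "w n = 0" if "n \<ge> 0" for n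
    using that g(2)[of "nat n"] h(2)[of "nat n"] by (simp add: w_def)
  have u_g: "u n = g n - (\<Sum>j=1..e. c' j * g (n - int j))" for n
  proof -
    have "u n = g n - (\<Sum>j=1..e. c' j * g (n - int j))
        - (h n - (\<Sum>j=1..e. c' j * h (n - int j)))"
      by (simp add: u_def w_def algebra_simps sum_subtractf)
    then show ?thesis using h(1)[of n] by simp
  qed
  have u_rec: "u n = (\<Sum>i=1..d. c i * u (n - int i))" for n
  proof -
    have "(\<Sum>j=1..e. c' j * g (n - int j))
        = (\<Sum>j=1..e. c' j * (\<Sum>i=1..d. c i * g (n - int j - int i)))"
      by (intro sum.cong refl arg_cong[where f = "(*) _"] g(1))
    also have "\<dots> = (\<Sum>i=1..d. c i * (\<Sum>j=1..e. c' j * g (n - int i - int j)))"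
      unfolding sum_distrib_left
      by (subst sum.swap) (intro sum.cong refl, simp add: algebra_simps)
    finally show ?thesis
      unfolding u_g using g(1)[of n] by (simp add: right_diff_distrib sum_subtractf)
  qed
  have "u n = 0" if "n \<ge> int e" for n
    using that by (simp add: u_def w0)
  then have "u n = 0" for n
    using recurrence_zero[of d c u "int e"] d u_rec by blast
  then have "w n = (\<Sum>j=1..e. c' j * w (n - int j))" for n
    unfolding u_def by (metis eq_iff_diff_eq_0)
  then have "w m = 0"
    using recurrence_zero[of e c' w 0] e w0 by blast
  then show "g m = h m" by (simp add: w_def)
qed

lemma extension_eqI: "is_extension f g \<Longrightarrow> extension f = g"
  unfolding extension_def by (blast intro: is_extension_unique)

end

theory Submission
  imports Defs
begin

text \<open>
  Let \<open>W h N\<close> be the total weight of the bounded paths from height \<open>h\<close> to height \<open>0\<close> over a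
  horizontal distance \<open>N\<close>. Removing the first step shows that \<open>V h m = W h (2 m + h)\<close> satisfies
  \<open>V h m = V (h + 1) (m - 1) + b h * V h (m - 1) + a h * V (h - 1) m\<close> for \<open>m > 0\<close>.
  Solving for \<open>V h (m - 1)\<close> runs this system backwards, and after rescaling row \<open>h\<close> by
  \<open>(- 1) ^ h * b 0 * \<dots> * b (h - 1)\<close> the backward system is the one for the weights \<open>b'\<close>, \<open>a'\<close>.
  Gluing both gives a family on all integers satisfying the system everywhere. Eliminating the rows
  from the top down leaves a linear recurrence for row \<open>0\<close> whose last coefficient is
  a product of the \<open>- b h\<close>, so row \<open>0\<close> is the extension.
\<close>

subsection \<open>Path sums\<close>

text \<open>\<open>N\<close> is the horizontal distance still to be covered. Only values with
  \<open>h \<le> k\<close> are path totals: from a start above \<open>k\<close> the recursion would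
  still admit horizontal and down steps.\<close>

fun path_sum :: "nat \<Rightarrow> (nat \<Rightarrow> 'a::field) \<Rightarrow> (nat \<Rightarrow> 'a) \<Rightarrow> nat \<Rightarrow> nat \<Rightarrow> 'a" where
  "path_sum k b a h 0 = (if h = 0 then 1 else 0)"
| "path_sum k b a h (Suc N) =
     (if h < k then path_sum k b a (Suc h) N else 0) +
     (case N of 0 \<Rightarrow> 0 | Suc M \<Rightarrow> b h * path_sum k b a h M) +
     (case h of 0 \<Rightarrow> 0 | Suc g \<Rightarrow> a h * path_sum k b a g N)"

text \<open>The end is fixed and the start arbitrary, because deleting the first vertex moves only
  the start.\<close>

definition paths_from :: "nat \<Rightarrow> int \<Rightarrow> point \<Rightarrow> point list set" where
  "paths_from k e p = {\<pi>. schroeder_path \<pi> \<and> hd \<pi> = p \<and> last \<pi> = (e, 0) \<and> (\<forall>q\<in>set \<pi>. snd q \<le> k)}"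

lemma paths_from_empty:
  assumes "fst p > e" shows "paths_from k e p = {}"
proof -
  have False if "\<pi> \<in> paths_from k e p" for \<pi>
  proof -
    from that have \<pi>: "schroeder_path \<pi>" "hd \<pi> = p" "last \<pi> = (e, 0)" "\<pi> \<noteq> []"
      by (simp_all add: paths_from_def schroeder_path_def)
    from \<pi>(4) have "last \<pi> \<in> set \<pi>" by (rule last_in_set)
    with \<pi>(1-3) show False using schroeder_path_bounds[of \<pi>] assms by fastforce
  qed
  then show ?thesis by blast
qed

lemma paths_from_empty_above:
  assumes "snd p > k" shows "paths_from k e p = {}"
  using assms hd_in_set unfolding paths_from_def schroeder_path_def by fastforce

lemma paths_from_rec:
  assumes "h \<le> k"
  shows "paths_from k e (x, h) =
    (if (x, h) = (e, 0) then {[(x, h)]} else {}) \<union>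
    Cons (x, h) ` paths_from k e (x + 1, Suc h) \<union>
    Cons (x, h) ` paths_from k e (x + 2, h) \<union>
    (case h of 0 \<Rightarrow> {} | Suc g \<Rightarrow> Cons (x, h) ` paths_from k e (x + 1, g))" (is "?L = ?R")
proof
  show "?R \<subseteq> ?L"
    using assms
    by (auto simp: paths_from_def schroeder_path_def successively_Cons up_step_def horiz_step_def
        down_step_def split: nat.splits if_splits)
  show "?L \<subseteq> ?R"
  proof
    fix \<pi> assume p: "\<pi> \<in> ?L"
    then obtain \<rho> where \<pi>: "\<pi> = (x, h) # \<rho>"
      unfolding paths_from_def schroeder_path_def by (cases \<pi>) auto
    show "\<pi> \<in> ?R"
    proof (cases \<rho>)
      case Nil
      then show ?thesis using p \<pi> by (auto simp: paths_from_def)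
    next
      case (Cons q \<tau>)
      have step: "up_step (x, h) q \<or> horiz_step (x, h) q \<or> down_step (x, h) q"
        and rest: "\<rho> \<in> paths_from k e q"
        using p \<pi> Cons by (auto simp: paths_from_def schroeder_path_def)
      from step have "q = (x + 1, Suc h) \<or> q = (x + 2, h) \<or> (\<exists>g. h = Suc g \<and> q = (x + 1, g))"
        by (cases q) (auto simp: up_step_def horiz_step_def down_step_def)
      then show ?thesis using rest \<pi> by auto
    qed
  qed
qed

text \<open>An arbitrary step relation \<open>S\<close> serves both products in \<open>wt\<close>.
  Prepending \<open>p\<close> shifts the old positions by one, and position 0 is the new
  step.\<close>

lemma prod_steps_Cons:
  fixes f :: "point \<Rightarrow> 'a::field"
  assumes "\<pi> \<noteq> []"
  shows "(\<Prod>j | Suc j < length (p # \<pi>) \<and> S ((p # \<pi>) ! j) ((p # \<pi>) ! Suc j). f ((p # \<pi>) ! j)) =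
    (if S p (hd \<pi>) then f p else 1) *
    (\<Prod>j | Suc j < length \<pi> \<and> S (\<pi> ! j) (\<pi> ! Suc j). f (\<pi> ! j))"
proof -
  let ?A = "{j. Suc j < length \<pi> \<and> S (\<pi> ! j) (\<pi> ! Suc j)}"
  have fin: "finite ?A" by (rule finite_subset[of _ "{..<length \<pi>}"]) auto
  have "{j. Suc j < length (p # \<pi>) \<and> S ((p # \<pi>) ! j) ((p # \<pi>) ! Suc j)} =
      (if S p (hd \<pi>) then {0} else {}) \<union> Suc ` ?A" (is "?B = _")
  proof (rule set_eqI)
    fix j show "j \<in> ?B \<longleftrightarrow> j \<in> (if S p (hd \<pi>) then {0} else {}) \<union> Suc ` ?A"
      using assms by (cases j) (auto simp: hd_conv_nth)
  qed
  then show ?thesis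
    using fin by (auto simp: prod.union_disjoint prod.reindex)
qed

lemma wt_Cons:
  assumes "\<pi> \<noteq> []"
  shows "wt (p # \<pi>) b a =
    (if horiz_step p (hd \<pi>) then b (snd p) else 1) *
    (if down_step p (hd \<pi>) then a (snd p) else 1) * wt \<pi> b a"
  unfolding wt_def
  using prod_steps_Cons[OF assms, where p = p and S = horiz_step and f = "\<lambda>p. b (snd p)"]
    prod_steps_Cons[OF assms, where p = p and S = down_step and f = "\<lambda>p. a (snd p)"]
  by (simp add: ac_simps)

lemma sum_wt_Cons:
  assumes "\<And>\<pi>. \<pi> \<in> A \<Longrightarrow> \<pi> \<noteq> [] \<and> hd \<pi> = q"
  shows "(\<Sum>\<pi>\<in>Cons p ` A. wt \<pi> b a) =
    (if horiz_step p q then b (snd p) else 1) *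
    (if down_step p q then a (snd p) else 1) * (\<Sum>\<pi>\<in>A. wt \<pi> b a)"
  using assms by (simp add: sum.reindex wt_Cons sum_distrib_left)

lemma paths_fromD: "\<pi> \<in> paths_from k e p \<Longrightarrow> \<pi> \<noteq> [] \<and> hd \<pi> = p"
  by (simp add: paths_from_def schroeder_path_def)

text \<open>Horizontal steps cover distance 2, hence strong induction. Finiteness is carried along
  because the sum is split over a union.\<close>

lemma sum_wt_paths_from:
  assumes "h \<le> k"
  shows "finite (paths_from k e (e - int N, h)) \<and>
    (\<Sum>\<pi>\<in>paths_from k e (e - int N, h). wt \<pi> b a) = path_sum k b a h N"
  using assms
proof (induction N arbitrary: h rule: less_induct)
  case (less N)
  let ?x = "e - int N"
  \<comment> \<open>Beyond the end point or above height \<open>k\<close> there are no paths, so the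
    total is 0 there.\<close>
  have IH: "finite (paths_from k e (?x + int d, g)) \<and>
      (\<Sum>\<pi>\<in>paths_from k e (?x + int d, g). wt \<pi> b a) =
      (if g \<le> k \<and> d \<le> N then path_sum k b a g (N - d) else 0)" if "d \<ge> 1" for d g
    using less.IH[of "N - d" g] that paths_from_empty[of e "(?x + int d, g)" k]
      paths_from_empty_above[of k "(?x + int d, g)" e]
    by (cases "d \<le> N"; cases "g \<le> k") (auto simp: of_nat_diff algebra_simps)
  define U where "U = Cons (?x, h) ` paths_from k e (?x + 1, Suc h)"
  define H where "H = Cons (?x, h) ` paths_from k e (?x + 2, h)"
  define D where "D = (case h of 0 \<Rightarrow> {} | Suc g \<Rightarrow> Cons (?x, h) ` paths_from k e (?x + 1, g))"
  define Z where "Z = (if N = 0 \<and> h = 0 then {[(?x, h)]} else {})"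
  have eq: "paths_from k e (?x, h) = Z \<union> U \<union> H \<union> D"
    unfolding U_def H_def D_def Z_def by (subst paths_from_rec[OF less.prems]) simp
  have fin: "finite Z" "finite U" "finite H" "finite D"
    unfolding U_def H_def D_def Z_def
    using IH[of 1] IH[of 2] by (auto split: nat.splits)
  \<comment> \<open>The second vertex, or its absence, tells the four pieces apart.\<close>
  have hds: "\<pi> \<in> U \<Longrightarrow> \<pi> \<noteq> [] \<and> tl \<pi> \<noteq> [] \<and> hd (tl \<pi>) = (?x + 1, Suc h)"
    "\<pi> \<in> H \<Longrightarrow> \<pi> \<noteq> [] \<and> tl \<pi> \<noteq> [] \<and> hd (tl \<pi>) = (?x + 2, h)"
    "\<pi> \<in> D \<Longrightarrow> \<pi> \<noteq> [] \<and> tl \<pi> \<noteq> [] \<and> (\<exists>g. h = Suc g \<and> hd (tl \<pi>) = (?x + 1, g))"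
    "\<pi> \<in> Z \<Longrightarrow> tl \<pi> = []" for \<pi>
    unfolding U_def H_def D_def Z_def
    by (auto dest: paths_fromD split: nat.splits if_splits)
  have disj: "Z \<inter> U = {}" "(Z \<union> U) \<inter> H = {}" "(Z \<union> U \<union> H) \<inter> D = {}"
    using hds by fastforce+
  have sums: "(\<Sum>\<pi>\<in>paths_from k e (?x, h). wt \<pi> b a) =
      sum (\<lambda>\<pi>. wt \<pi> b a) Z + sum (\<lambda>\<pi>. wt \<pi> b a) U + sum (\<lambda>\<pi>. wt \<pi> b a) H + sum (\<lambda>\<pi>. wt \<pi> b a) D"
    unfolding eq using fin disj by (simp add: sum.union_disjoint)
  have sU: "sum (\<lambda>\<pi>. wt \<pi> b a) U = (if h < k \<and> 1 \<le> N then path_sum k b a (Suc h) (N - 1) else 0)"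
    unfolding U_def using IH[of 1 "Suc h"]
    by (subst sum_wt_Cons[OF paths_fromD]) (auto simp: horiz_step_def down_step_def)
  have sH: "sum (\<lambda>\<pi>. wt \<pi> b a) H = (if 2 \<le> N then b h * path_sum k b a h (N - 2) else 0)"
    unfolding H_def using IH[of 2 h] less.prems
    by (subst sum_wt_Cons[OF paths_fromD]) (auto simp: horiz_step_def down_step_def)
  have sD: "sum (\<lambda>\<pi>. wt \<pi> b a) D =
      (case h of 0 \<Rightarrow> 0 | Suc g \<Rightarrow> if 1 \<le> N then a h * path_sum k b a g (N - 1) else 0)"
  proof (cases h)
    case 0
    then show ?thesis by (simp add: D_def)
  next
    case (Suc g)
    then have "D = Cons (?x, h) ` paths_from k e (?x + 1, g)" by (simp add: D_def)
    then show ?thesis using IH[of 1 g] less.prems Suc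
      by (simp only:, subst sum_wt_Cons[OF paths_fromD]) (auto simp: horiz_step_def down_step_def)
  qed
  have sZ: "sum (\<lambda>\<pi>. wt \<pi> b a) Z = (if N = 0 \<and> h = 0 then 1 else 0)"
    by (simp add: Z_def wt_def)
  have "(\<Sum>\<pi>\<in>paths_from k e (?x, h). wt \<pi> b a) = path_sum k b a h N"
    unfolding sums sU sH sD sZ
    by (cases N) (auto split: nat.splits)
  then show ?case unfolding eq using fin by simp
qed

lemma sigma_eq_path_sum: "sigma k b a n = path_sum k b a 0 (2 * n)"
  using sum_wt_paths_from[of 0 k "int (2 * n)" "2 * n" b a]
  by (simp add: sigma_def Sch_def paths_from_def)

text \<open>Distances are now integers, so that the recurrence holds without case distinctions on them.\<close>

definition path_sum_int :: "nat \<Rightarrow> (nat \<Rightarrow> 'a::field) \<Rightarrow> (nat \<Rightarrow> 'a) \<Rightarrow> nat \<Rightarrow> int \<Rightarrow> 'a" where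
  "path_sum_int k b a h N = (if N < 0 \<or> h > k then 0 else path_sum k b a h (nat N))"

lemma path_sum_int_rec:
  assumes "h \<le> k"
  shows "path_sum_int k b a h N =
    (if h = 0 \<and> N = 0 then 1 else 0) + path_sum_int k b a (Suc h) (N - 1) +
    b h * path_sum_int k b a h (N - 2) +
    (if h = 0 then 0 else a h * path_sum_int k b a (h - 1) (N - 1))"
proof (cases "N \<le> 0")
  case True
  then show ?thesis using assms by (auto simp: path_sum_int_def)
next
  case False
  then obtain M where N: "N = int (Suc M)" by (metis gr0_conv_Suc not_le zero_less_imp_eq_int)
  have "nat N = Suc M" "nat (N - 1) = M" "nat (N - 2) = M - 1" "N - 2 < 0 \<longleftrightarrow> M = 0" "\<not> N - 1 < 0" "N \<noteq> 0"
    using N by auto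
  then show ?thesis
    using assms False unfolding path_sum_int_def by (auto split: nat.splits)
qed

text \<open>Each step covers distance at least 1 and lowers the height by at most 1. This settles
  the equations at \<open>m = 0\<close>, where the two halves of \<open>two_sided\<close>
  meet.\<close>

lemma path_sum_int_short: "N < int h \<Longrightarrow> path_sum_int k b a h N = 0"
proof (induction "nat N" arbitrary: N h rule: less_induct)
  case less
  show ?case
  proof (cases "N < 0 \<or> h > k")
    case True
    then show ?thesis by (auto simp: path_sum_int_def)
  next
    case False
    have "path_sum_int k b a g M = 0" if "M < N" "M < int g" for g M
    proof (cases "M < 0")
      case True
      then show ?thesis by (simp add: path_sum_int_def)
    next
      case M: False
      then show ?thesis using less.hyps[of M g] that by auto
    qed
    then show ?thesis
      using False less.prems by (subst path_sum_int_rec) auto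
  qed
qed

subsection \<open>Elimination of rows\<close>

text \<open>
  The polynomial in the backward shift whose coefficients are those of the denominator of the
  continued fraction truncated to heights \<open>h, \<dots>, h + m - 1\<close>.
\<close>

fun eliminant :: "(nat \<Rightarrow> 'a::field) \<Rightarrow> (nat \<Rightarrow> 'a) \<Rightarrow> nat \<Rightarrow> nat \<Rightarrow> (int \<Rightarrow> 'a) \<Rightarrow> int \<Rightarrow> 'a" where
  "eliminant b a h 0 f n = f n"
| "eliminant b a h (Suc 0) f n = f n - b h * f (n - 1)"
| "eliminant b a h (Suc (Suc m)) f n =
     eliminant b a (Suc h) (Suc m) f n - b h * eliminant b a (Suc h) (Suc m) f (n - 1)
     - a (Suc h) * eliminant b a (Suc (Suc h)) m f (n - 1)"

text \<open>This form makes \<open>eliminant\<close> visibly linear and shift-invariant;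
  \<open>c m \<noteq> 0\<close> is what \<open>satisfies_recurrence\<close> demands of the last
  coefficient.\<close>

lemma eliminant_coeffs:
  fixes b a :: "nat \<Rightarrow> 'a::field"
  assumes "\<And>i. b i \<noteq> 0"
  shows "\<exists>c. c 0 = 1 \<and> c m \<noteq> 0 \<and> (\<forall>i>m. c i = 0) \<and>
    (\<forall>f n. eliminant b a h m f n = (\<Sum>i\<le>m. c i * f (n - int i)))"
proof (induction m arbitrary: h rule: less_induct)
  case (less m)
  consider "m = 0" | "m = 1" | l where "m = Suc (Suc l)"
    by (metis One_nat_def old.nat.exhaust)
  then show ?case
  proof cases
    case 1
    then show ?thesis by (intro exI[of _ "\<lambda>i. if i = 0 then 1 else 0"]) simp
  next
    case 2
    then show ?thesis using assms[of h]
      by (intro exI[of _ "\<lambda>i. if i = 0 then 1 else if i = 1 then - b h else 0"]) simp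
  next
    case (3 l)
    obtain c where c: "c 0 = 1" "c (Suc l) \<noteq> 0" "\<And>i. i > Suc l \<Longrightarrow> c i = 0"
      "\<And>f n. eliminant b a (Suc h) (Suc l) f n = (\<Sum>i\<le>Suc l. c i * f (n - int i))"
      using less.IH[of "Suc l" "Suc h"] 3 by auto
    obtain c' where c': "\<And>i. i > l \<Longrightarrow> c' i = 0"
      "\<And>f n. eliminant b a (Suc (Suc h)) l f n = (\<Sum>i\<le>l. c' i * f (n - int i))"
      using less.IH[of l "Suc (Suc h)"] 3 by auto
    \<comment> \<open>At the top index only one term survives:
      \<open>C m = - b h * c (Suc l)\<close>.\<close>
    define C where "C i = c i - (case i of 0 \<Rightarrow> 0 | Suc j \<Rightarrow> b h * c j + a (Suc h) * c' j)" for i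
    have "C 0 = 1" "C m \<noteq> 0" "\<forall>i>m. C i = 0"
      using c(1-3) c'(1) assms[of h] 3 by (auto simp: C_def split: nat.splits)
    moreover have "eliminant b a h m f n = (\<Sum>i\<le>m. C i * f (n - int i))" for f n
    proof -
      have 1: "(\<Sum>i\<le>Suc l. c i * f (n - int i)) = (\<Sum>i\<le>Suc (Suc l). c i * f (n - int i))"
        using c(3)[of "Suc (Suc l)"] by simp
      have 2: "(\<Sum>i\<le>l. c' i * f (n - 1 - int i)) = (\<Sum>i\<le>Suc l. c' i * f (n - 1 - int i))"
        using c'(1)[of "Suc l"] by simp
      have "(\<Sum>i\<le>m. C i * f (n - int i)) = (\<Sum>i\<le>Suc (Suc l). c i * f (n - int i))
          - (\<Sum>i\<le>Suc (Suc l). (case i of 0 \<Rightarrow> 0 | Suc j \<Rightarrow> b h * c j + a (Suc h) * c' j) * f (n - int i))"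
        unfolding C_def 3 by (simp only: left_diff_distrib sum_subtractf)
      also have "(\<Sum>i\<le>Suc (Suc l). (case i of 0 \<Rightarrow> 0 | Suc j \<Rightarrow> b h * c j + a (Suc h) * c' j) * f (n - int i))
          = (\<Sum>i\<le>Suc l. (b h * c i + a (Suc h) * c' i) * f (n - 1 - int i))"
        by (subst sum.atMost_Suc_shift) (simp add: algebra_simps)
      also have "\<dots> = b h * (\<Sum>i\<le>Suc l. c i * f (n - 1 - int i))
          + a (Suc h) * (\<Sum>i\<le>Suc l. c' i * f (n - 1 - int i))"
        by (simp only: sum_distrib_left distrib_right sum.distrib mult.assoc)
      finally show ?thesis
        unfolding 3 eliminant.simps(3) c(4) c'(2) 1 2 by (simp only: diff_diff_eq)
    qed
    ultimately show ?thesis by blast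
  qed
qed

text \<open>The induction goes from row \<open>k\<close> downwards. The right-hand argument is the
  defect of row \<open>h\<close>: it equals \<open>a h * V (h - 1)\<close> in positive rows and will
  be 0 in row 0.\<close>

lemma eliminant_row:
  fixes b a :: "nat \<Rightarrow> 'a::field" and V :: "nat \<Rightarrow> int \<Rightarrow> 'a"
  assumes b: "\<And>i. b i \<noteq> 0"
    and rec: "\<And>h n. h < k \<Longrightarrow>
      V (Suc h) n = V (Suc (Suc h)) (n - 1) + b (Suc h) * V (Suc h) (n - 1) + a (Suc h) * V h n"
    and top: "\<And>n. V (Suc k) n = 0"
    and "h + m = k"
  shows "eliminant b a h (Suc m) (V h) n =
    eliminant b a (Suc h) m (\<lambda>n. V h n - V (Suc h) (n - 1) - b h * V h (n - 1)) n"
  using \<open>h + m = k\<close>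
proof (induction m arbitrary: h n)
  case 0
  then show ?case using top by simp
next
  case (Suc m)
  have row: "V (Suc h) n - V (Suc (Suc h)) (n - 1) - b (Suc h) * V (Suc h) (n - 1) = a (Suc h) * V h n" for n
    using rec[of h n] Suc.prems by simp
  have IH: "eliminant b a (Suc h) (Suc m) (V (Suc h)) n
      = eliminant b a (Suc (Suc h)) m (\<lambda>n. a (Suc h) * V h n) n" for n
    using Suc.IH[of "Suc h" n] Suc.prems unfolding row by simp
  obtain c where c: "\<And>f n. eliminant b a (Suc h) (Suc m) f n = (\<Sum>i\<le>Suc m. c i * f (n - int i))"
    using eliminant_coeffs[where b = b and a = a and h = "Suc h" and m = "Suc m", OF b] by blast
  obtain c' where c': "\<And>f n. eliminant b a (Suc (Suc h)) m f n = (\<Sum>i\<le>m. c' i * f (n - int i))"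
    using eliminant_coeffs[where b = b and a = a and h = "Suc (Suc h)" and m = m, OF b] by blast
  \<comment> \<open>Linearity pulls out \<open>a (Suc h)\<close>. Nothing is divided by it, so it
    may be zero.\<close>
  have "a (Suc h) * eliminant b a (Suc (Suc h)) m (V h) n
      = eliminant b a (Suc h) (Suc m) (V (Suc h)) n" for n
    unfolding IH c' by (simp add: sum_distrib_left ac_simps)
  then have "eliminant b a h (Suc (Suc m)) (V h) n =
      eliminant b a (Suc h) (Suc m) (V h) n - b h * eliminant b a (Suc h) (Suc m) (V h) (n - 1)
      - eliminant b a (Suc h) (Suc m) (V (Suc h)) (n - 1)"
    by simp
  also have "\<dots> = eliminant b a (Suc h) (Suc m) (\<lambda>n. V h n - V (Suc h) (n - 1) - b h * V h (n - 1)) n"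
    unfolding c right_diff_distrib sum_subtractf sum_distrib_left
    by (simp add: algebra_simps)
  finally show ?case .
qed

lemma is_extension_row:
  fixes b a :: "nat \<Rightarrow> 'a::field" and V :: "nat \<Rightarrow> int \<Rightarrow> 'a"
  assumes b: "\<And>i. b i \<noteq> 0"
    and rec: "\<And>h n. h \<le> k \<Longrightarrow> V h n =
      V (Suc h) (n - 1) + b h * V h (n - 1) + (if h = 0 then 0 else a h * V (h - 1) n)"
    and top: "\<And>n. V (Suc k) n = 0"
    and f: "\<And>n. V 0 (int n) = f n"
  shows "is_extension f (V 0)"
proof -
  obtain c where c: "c 0 = 1" "c (Suc k) \<noteq> 0"
    and el: "\<And>f n. eliminant b a 0 (Suc k) f n = (\<Sum>i\<le>Suc k. c i * f (n - int i))"
    using eliminant_coeffs[where b = b and a = a and h = 0 and m = "Suc k", OF b] by blast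
  obtain c' where c': "\<And>f n. eliminant b a (Suc 0) k f n = (\<Sum>i\<le>k. c' i * f (n - int i))"
    using eliminant_coeffs[where b = b and a = a and h = "Suc 0" and m = k, OF b] by blast
  \<comment> \<open>Row 0 has no lower neighbour, so its defect vanishes and the eliminant
    annihilates \<open>V 0\<close>.\<close>
  have row: "V 0 n - V (Suc 0) (n - 1) - b 0 * V 0 (n - 1) = 0" for n
    by (subst rec[of 0 n]) simp_all
  have "(\<Sum>i\<le>Suc k. c i * V 0 (n - int i)) = 0" for n
  proof -
    have "eliminant b a 0 (Suc k) (V 0) n
        = eliminant b a (Suc 0) k (\<lambda>n. V 0 n - V (Suc 0) (n - 1) - b 0 * V 0 (n - 1)) n"
    proof (rule eliminant_row[where V = V])
      show "V (Suc h) n = V (Suc (Suc h)) (n - 1) + b (Suc h) * V (Suc h) (n - 1) + a (Suc h) * V h n"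
        if "h < k" for h n
        by (subst rec) (use that in simp_all)
    qed (simp_all add: b top)
    then show ?thesis
      unfolding row el c' by simp
  qed
  then have "V 0 n + (\<Sum>i=1..Suc k. c i * V 0 (n - int i)) = 0" for n
    using c(1) by (simp only: atMost_atLeast0 sum.atLeast_Suc_atMost[OF le0]) simp
  then have glob: "V 0 n = (\<Sum>i=1..Suc k. - c i * V 0 (n - int i))" for n
    by (simp only: mult_minus_left sum_negf) (simp only: eq_neg_iff_add_eq_0)
  \<comment> \<open>For \<open>n \<ge> Suc k\<close> the truncated differences \<open>n - i\<close>
    agree with the integer ones.\<close>
  have "f n = (\<Sum>i=1..Suc k. - c i * f (n - i))" if "n \<ge> Suc k" for n
    unfolding f[symmetric] using that
    by (subst glob) (intro sum.cong, auto simp: of_nat_diff)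
  then have "satisfies_recurrence (Suc k) (\<lambda>i. - c i) f"
    using c(2) by (simp add: satisfies_recurrence_def)
  then show ?thesis
    using glob f unfolding is_extension_def by blast
qed

subsection \<open>The two-sided family\<close>

text \<open>Distance and starting height have equal parity, so \<open>m\<close> is half the excess
  of the distance over \<open>h\<close>. The factor \<open>inverse (b 0)\<close> is forced by row 0
  at \<open>m = 0\<close>, which reads \<open>1 = b 0 * V 0 (- 1)\<close>.\<close>

definition two_sided ::
  "nat \<Rightarrow> (nat \<Rightarrow> 'a::field) \<Rightarrow> (nat \<Rightarrow> 'a) \<Rightarrow> (nat \<Rightarrow> 'a) \<Rightarrow> (nat \<Rightarrow> 'a) \<Rightarrow> nat \<Rightarrow> int \<Rightarrow> 'a" where
  "two_sided k b a b' a' h m =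
     (if m \<ge> 0 then path_sum_int k b a h (2 * m + int h)
      else (- 1) ^ h * (\<Prod>i<h. b i) * inverse (b 0) * path_sum_int k b' a' h (- 2 * m - 2 - int h))"

lemma two_sided_rec:
  fixes b a b' a' :: "nat \<Rightarrow> 'a::field"
  assumes b: "\<And>i. b i \<noteq> 0"
    and b': "\<And>i. b' i = inverse (b i)"
    and a': "\<And>i. i \<ge> 1 \<Longrightarrow> a' i = a i * inverse (b (i - 1)) * inverse (b i)"
    and "h \<le> k"
  defines "V \<equiv> two_sided k b a b' a'"
  shows "V h m = V (Suc h) (m - 1) + b h * V h (m - 1) + (if h = 0 then 0 else a h * V (h - 1) m)"
proof -
  consider "m > 0" | "m = 0" | "m < 0" by linarith
  then show ?thesis
  proof cases
    case 1
    then show ?thesis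
      unfolding V_def two_sided_def
      using path_sum_int_rec[OF \<open>h \<le> k\<close>, of b a "2 * m + int h"]
      by (cases h) (simp_all add: algebra_simps)
  next
    case 2
    \<comment> \<open>At \<open>m - 1 = - 1\<close> the backward distance from height
      \<open>g\<close> is \<open>- g\<close>, so only row 0 contributes.\<close>
    have short: "path_sum_int k b' a' g (- int g) = 0" if "g > 0" for g
      using that by (simp add: path_sum_int_short)
    have "path_sum_int k b' a' 0 0 = 1" by (simp add: path_sum_int_def)
    moreover have "path_sum_int k b a (Suc h) (int h - 1) = 0" "path_sum_int k b a h (int h - 2) = 0"
      by (simp_all add: path_sum_int_short)
    ultimately show ?thesis
      using 2 b[of 0] short[of h] short[of "Suc h"] path_sum_int_rec[OF \<open>h \<le> k\<close>, of b a "int h"]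
      unfolding V_def two_sided_def
      by (cases h) (simp_all add: algebra_simps)
  next
    case 3
    \<comment> \<open>\<open>N\<close> is the distance belonging to \<open>V h (m - 1)\<close>, and
      \<open>r\<close> is the scale of row \<open>h\<close>; passing to row \<open>h + 1\<close>
      multiplies the scale by \<open>- b h\<close>.\<close>
    define N where "N = - 2 * m - int h"
    define r where "r = (- 1) ^ h * (\<Prod>i<h. b i) * inverse (b 0)"
    have V1: "V h m = r * path_sum_int k b' a' h (N - 2)"
      using 3 by (simp add: V_def two_sided_def r_def N_def algebra_simps)
    have V2: "V h (m - 1) = r * path_sum_int k b' a' h N"
      using 3 by (simp add: V_def two_sided_def r_def N_def algebra_simps)
    have V3: "V (Suc h) (m - 1) = - b h * r * path_sum_int k b' a' (Suc h) (N - 1)"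
      using 3 by (simp add: V_def two_sided_def r_def N_def algebra_simps)
    \<comment> \<open>Row \<open>h - 1\<close> has scale \<open>- r / b (h - 1)\<close>, and
      \<open>a h / b (h - 1) = b h * a' h\<close>; this is where the form of \<open>a'\<close> comes
      from.\<close>
    have V4: "a h * V (h - 1) m = - r * b h * (a' h * path_sum_int k b' a' (h - 1) (N - 1))" if "h \<noteq> 0"
    proof -
      obtain g where g: "h = Suc g" using \<open>h \<noteq> 0\<close> not0_implies_Suc by blast
      show ?thesis
        using 3 b[of g] b[of h] a'[of h] unfolding g
        by (simp add: V_def two_sided_def r_def N_def g algebra_simps)
    qed
    have "\<not> (h = 0 \<and> N = 0)"
      using 3 by (auto simp: N_def)
    then have row: "path_sum_int k b' a' h N = path_sum_int k b' a' (Suc h) (N - 1)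
        + inverse (b h) * path_sum_int k b' a' h (N - 2)
        + (if h = 0 then 0 else a' h * path_sum_int k b' a' (h - 1) (N - 1))"
      using path_sum_int_rec[OF \<open>h \<le> k\<close>, of b' a' N] unfolding b' by simp
    \<comment> \<open>Multiplying by \<open>b h\<close> clears the coefficient of the
      \<open>N - 2\<close> term, the one that belongs to \<open>V h m\<close>.\<close>
    have "b h * path_sum_int k b' a' h N = b h * path_sum_int k b' a' (Suc h) (N - 1)
        + path_sum_int k b' a' h (N - 2)
        + (if h = 0 then 0 else b h * (a' h * path_sum_int k b' a' (h - 1) (N - 1)))"
      unfolding row using b[of h] by (simp add: distrib_left mult.assoc[symmetric])
    then have "path_sum_int k b' a' h (N - 2) = b h * path_sum_int k b' a' h N
        - b h * path_sum_int k b' a' (Suc h) (N - 1)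
        - (if h = 0 then 0 else b h * (a' h * path_sum_int k b' a' (h - 1) (N - 1)))"
      by simp
    then show ?thesis
      unfolding V1 V2 V3 using V4 by (cases "h = 0") (simp_all add: right_diff_distrib mult_ac)
  qed
qed

theorem theorem9p6:
  fixes b a b' a' :: "nat \<Rightarrow> 'a::field" and n k :: nat
  assumes b_nonzero: "\<And>i. b i \<noteq> 0"
    and b'_def: "\<And>i. b' i = inverse (b i)"
    and a'_def: "\<And>i. i \<ge> 1 \<Longrightarrow> a' i = a i * inverse (b (i - 1)) * inverse (b i)"
    and "n \<ge> 1" and "k \<ge> 1"
  shows "sigma_ext k b a (- int n) = inverse (b 0) * (\<Sum>\<pi>\<in>Sch k (2 * n - 2). wt \<pi> b' a') \<and>
         inverse (b 0) * (\<Sum>\<pi>\<in>Sch k (2 * n - 2). wt \<pi> b' a') = inverse (b 0) * sigma k b' a' (n - 1)"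
proof -
  let ?V = "two_sided k b a b' a'"
  have "is_extension (sigma k b a) (?V 0)"
  proof (rule is_extension_row[where b = b and a = a and k = k])
    show "?V h m = ?V (Suc h) (m - 1) + b h * ?V h (m - 1) + (if h = 0 then 0 else a h * ?V (h - 1) m)"
      if "h \<le> k" for h m
      using that by (intro two_sided_rec b_nonzero b'_def a'_def)
    show "?V (Suc k) m = 0" for m
      by (simp add: two_sided_def path_sum_int_def)
    show "?V 0 (int m) = sigma k b a m" for m
      by (simp add: two_sided_def path_sum_int_def sigma_eq_path_sum nat_mult_distrib)
  qed (rule b_nonzero)
  then have "sigma_ext k b a (- int n) = ?V 0 (- int n)"
    unfolding sigma_ext_def by (simp add: extension_eqI)
  also have "\<dots> = inverse (b 0) * sigma k b' a' (n - 1)"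
  proof -
    \<comment> \<open>With \<open>n = Suc l\<close> the backward distance \<open>2 * n - 2\<close>
      becomes \<open>2 * l\<close>.\<close>
    obtain l where "n = Suc l" using \<open>n \<ge> 1\<close> by (cases n) auto
    then show ?thesis
      by (simp add: two_sided_def path_sum_int_def sigma_eq_path_sum nat_mult_distrib)
  qed
  finally have "sigma_ext k b a (- int n) = inverse (b 0) * sigma k b' a' (n - 1)" .
  moreover have "2 * (n - 1) = 2 * n - 2" by simp
  ultimately show ?thesis unfolding sigma_def by simp
qed

end
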